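(* The set $\{\ell_{\mathcal A}^{2} \mid \mathcal A \subseteq A_n,\ \mathcal A \text{ connected}\}$ generates the pure braid group $\mathrm{PBr}_{A_n}$.
   Context: Let $n\ge 1$. The braid group $\mathrm{Br}_{n+1}$ is the group with generators $s_1,\dots,s_n$ and relations $s_is_j=s_js_i$ for $|i-j|\ge 2$ and $s_is_{i+1}s_i=s_{i+1}s_is_{i+1}$ for $1\le i\le n-1$. The pure braid group $\mathrm{PBr}_{A_n}$ is the kernel of the homomorphism $\mathrm{Br}_{n+1}\to\mathfrak{S}_{n+1}$ sending $s_i$ to the transposition $(i,i+1)$. $A_n$ denotes the path graph (Dynkin graph) with nodes $1,2,\dots,n$ and edges between consecutive nodes. A (nonempty) connected subgraph $\mathcal A$ is an interval $[i,j]=\{i,i+1,\dots,j\}$ with $1\le i\le j\le n$. For such $\mathcal A=[i,j]$, $\ell_{\mathcal A}=\ell_{i,j}\in \mathrm{Br}_{n+1}$ denotes the standard positive lift of the longest element of the parabolic subgroup of $\mathfrak{S}_{n+1}$ generated by $(i,i+1),\dots,(j,j+1)$; explicitly $\ell_{i,j}=(s_i)(s_{i+1}s_i)(s_{i+2}s_{i+1}s_i)\cdots(s_j s_{j-1}\cdots s_i)$, with $\ell_{i,i}=s_i$. *)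

theory Defs
  imports "HOL-Algebra.Sym_Groups" "HOL-Algebra.Generated_Groups"
    "Graph_Theory.Digraph_Component"
begin

section \<open>Groups given by generators and relations\<close>

text \<open>
  A word over \<open>S\<close> is a list of letters \<open>(a, b)\<close> with \<open>a \<in> S\<close>; the letter \<open>(a, True)\<close> stands
  for the generator \<open>a\<close> and \<open>(a, False)\<close> for its formal inverse. A set \<open>R\<close> of pairs of words
  is read as the set of relations \<open>l = r\<close> with \<open>(l, r) \<in> R\<close>.
\<close>

type_synonym 'a gword = "('a \<times> bool) list"

definition words :: "'a set \<Rightarrow> 'a gword set" where
  "words S = lists (S \<times> UNIV)"

inductive word_eq :: "'a set \<Rightarrow> ('a gword \<times> 'a gword) set \<Rightarrow> 'a gword \<Rightarrow> 'a gword \<Rightarrow> bool"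
  for S R where
  refl: "u \<in> words S \<Longrightarrow> word_eq S R u u"
| sym: "word_eq S R u v \<Longrightarrow> word_eq S R v u"
| trans: "word_eq S R u v \<Longrightarrow> word_eq S R v w \<Longrightarrow> word_eq S R u w"
| cancel: "a \<in> S \<Longrightarrow> u \<in> words S \<Longrightarrow> v \<in> words S \<Longrightarrow>
    word_eq S R (u @ [(a, b), (a, \<not> b)] @ v) (u @ v)"
| rel: "(l, r) \<in> R \<Longrightarrow> l \<in> words S \<Longrightarrow> r \<in> words S \<Longrightarrow> u \<in> words S \<Longrightarrow> v \<in> words S \<Longrightarrow>
    word_eq S R (u @ l @ v) (u @ r @ v)"

definition word_rel :: "'a set \<Rightarrow> ('a gword \<times> 'a gword) set \<Rightarrow> 'a gword rel" where
  "word_rel S R = {(u, v). word_eq S R u v}"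

abbreviation word_class :: "'a set \<Rightarrow> ('a gword \<times> 'a gword) set \<Rightarrow> 'a gword \<Rightarrow> 'a gword set" where
  "word_class S R w \<equiv> word_rel S R `` {w}"

definition presented_group ::
  "'a set \<Rightarrow> ('a gword \<times> 'a gword) set \<Rightarrow> 'a gword set monoid" where
  "presented_group S R = \<lparr>
     carrier = words S // word_rel S R,
     mult = (\<lambda>X Y. \<Union>x\<in>X. \<Union>y\<in>Y. word_class S R (x @ y)),
     one = word_class S R [] \<rparr>"

primrec word_eval :: "('b, 'm) monoid_scheme \<Rightarrow> ('a \<Rightarrow> 'b) \<Rightarrow> 'a gword \<Rightarrow> 'b" where
  "word_eval G f [] = \<one>\<^bsub>G\<^esub>"
| "word_eval G f (x # w) =
     (if snd x then f (fst x) else inv\<^bsub>G\<^esub> f (fst x)) \<otimes>\<^bsub>G\<^esub> word_eval G f w"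

text \<open>
  The map induced by \<open>f\<close> on classes of words; it is meaningful when \<open>f\<close> respects the relations,
  as then \<^term>\<open>word_eval G f\<close> is constant on each class (see \<open>presented_lift_class\<close>).
\<close>

definition presented_lift ::
  "('b, 'm) monoid_scheme \<Rightarrow> ('a \<Rightarrow> 'b) \<Rightarrow> 'a gword set \<Rightarrow> 'b" where
  "presented_lift G f X = the_elem (word_eval G f ` X)"

lemma words_simps [simp]:
  "[] \<in> words S"
  "x # w \<in> words S \<longleftrightarrow> fst x \<in> S \<and> w \<in> words S"
  "u @ v \<in> words S \<longleftrightarrow> u \<in> words S \<and> v \<in> words S"
  by (auto simp: words_def mem_Times_iff)

lemma word_eq_words: "word_eq S R u v \<Longrightarrow> u \<in> words S \<and> v \<in> words S"
  by (induction rule: word_eq.induct) auto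

lemma word_eq_append_left: "word_eq S R u v \<Longrightarrow> w \<in> words S \<Longrightarrow> word_eq S R (w @ u) (w @ v)"
proof (induction rule: word_eq.induct)
  case (cancel a u v b)
  then show ?case using word_eq.cancel[of a S "w @ u" v R b] by simp
next
  case (rel l r u v)
  then show ?case using word_eq.rel[of l r R S "w @ u" v] by simp
qed (auto intro: word_eq.refl word_eq.sym word_eq.trans)

lemma word_eq_append_right: "word_eq S R u v \<Longrightarrow> w \<in> words S \<Longrightarrow> word_eq S R (u @ w) (v @ w)"
proof (induction rule: word_eq.induct)
  case (cancel a u v b)
  then show ?case using word_eq.cancel[of a S u "v @ w" R b] by simp
next
  case (rel l r u v)
  then show ?case using word_eq.rel[of l r R S u "v @ w"] by simp
qed (auto intro: word_eq.refl word_eq.sym word_eq.trans)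

lemma word_eq_append:
  "word_eq S R u u' \<Longrightarrow> word_eq S R v v' \<Longrightarrow> word_eq S R (u @ v) (u' @ v')"
  by (meson word_eq.trans word_eq_append_left word_eq_append_right word_eq_words)

lemma equiv_word_rel: "equiv (words S) (word_rel S R)"
  by (rule equivI)
     (auto simp: word_rel_def refl_on_def intro!: symI transI
       intro: word_eq.refl word_eq.sym word_eq.trans dest: word_eq_words)

lemma word_class_eq_iff:
  "u \<in> words S \<Longrightarrow> v \<in> words S \<Longrightarrow> word_class S R u = word_class S R v \<longleftrightarrow> word_eq S R u v"
  using eq_equiv_class_iff[OF equiv_word_rel, of u S v R] unfolding word_rel_def by blast

lemma presented_group_one: "\<one>\<^bsub>presented_group S R\<^esub> = word_class S R []"
  by (simp add: presented_group_def)

lemma presented_group_carrier: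
  "X \<in> carrier (presented_group S R) \<longleftrightarrow> (\<exists>u \<in> words S. X = word_class S R u)"
  by (auto simp: presented_group_def quotient_def)

lemma presented_group_mult:
  assumes "u \<in> words S" "v \<in> words S"
  shows "word_class S R u \<otimes>\<^bsub>presented_group S R\<^esub> word_class S R v = word_class S R (u @ v)"
proof -
  have "word_class S R (x @ y) = word_class S R (u @ v)"
    if "word_eq S R u x" "word_eq S R v y" for x y
    using that assms
    by (subst word_class_eq_iff) (auto dest: word_eq_words intro: word_eq_append word_eq.sym)
  moreover have "u \<in> word_class S R u" "v \<in> word_class S R v"
    using assms by (auto simp: word_rel_def intro: word_eq.refl)
  ultimately have "(\<Union>x\<in>word_class S R u. \<Union>y\<in>word_class S R v. word_class S R (x @ y)) =
      word_class S R (u @ v)"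
    unfolding word_rel_def by blast
  then show ?thesis by (simp add: presented_group_def)
qed

definition inv_word :: "'a gword \<Rightarrow> 'a gword" where
  "inv_word w = rev (map (\<lambda>(a, b). (a, \<not> b)) w)"

lemma inv_word_words: "w \<in> words S \<Longrightarrow> inv_word w \<in> words S"
  by (auto simp: inv_word_def words_def)

lemma inv_word_left: "w \<in> words S \<Longrightarrow> word_eq S R (inv_word w @ w) []"
proof (induction w)
  case Nil
  then show ?case by (simp add: inv_word_def word_eq.refl)
next
  case (Cons x w)
  obtain a b where x: "x = (a, b)" by fastforce
  have "word_eq S R (inv_word w @ [(a, \<not> b), (a, \<not> \<not> b)] @ w) (inv_word w @ w)"
    using Cons.prems x by (intro word_eq.cancel) (auto simp: inv_word_words)
  then show ?case
    using Cons x by (auto simp: inv_word_def intro: word_eq.trans)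
qed

lemma presented_group_is_group: "group (presented_group S R)"
proof (rule groupI)
  fix X assume "X \<in> carrier (presented_group S R)"
  then obtain u where u: "u \<in> words S" "X = word_class S R u"
    by (auto simp: presented_group_carrier)
  show "\<exists>Y\<in>carrier (presented_group S R). Y \<otimes>\<^bsub>presented_group S R\<^esub> X = \<one>\<^bsub>presented_group S R\<^esub>"
  proof (rule bexI)
    show "word_class S R (inv_word u) \<otimes>\<^bsub>presented_group S R\<^esub> X = \<one>\<^bsub>presented_group S R\<^esub>"
      using u by (simp add: presented_group_mult inv_word_words presented_group_one
          word_class_eq_iff inv_word_left)
    show "word_class S R (inv_word u) \<in> carrier (presented_group S R)"
      using u inv_word_words presented_group_carrier by blast
  qed
  show "\<one>\<^bsub>presented_group S R\<^esub> \<otimes>\<^bsub>presented_group S R\<^esub> X = X"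
    using u by (simp add: presented_group_one presented_group_mult)
next
  show "\<one>\<^bsub>presented_group S R\<^esub> \<in> carrier (presented_group S R)"
    unfolding presented_group_one presented_group_carrier by force
next
  fix X Y assume "X \<in> carrier (presented_group S R)" "Y \<in> carrier (presented_group S R)"
  then obtain u v where "u \<in> words S" "X = word_class S R u" "v \<in> words S" "Y = word_class S R v"
    by (auto simp: presented_group_carrier)
  then show "X \<otimes>\<^bsub>presented_group S R\<^esub> Y \<in> carrier (presented_group S R)"
    by (simp add: presented_group_mult presented_group_carrier)
       (metis words_simps(3))
next
  fix X Y Z
  assume "X \<in> carrier (presented_group S R)" "Y \<in> carrier (presented_group S R)"
    "Z \<in> carrier (presented_group S R)"
  then obtain u v w where "u \<in> words S" "X = word_class S R u"
      "v \<in> words S" "Y = word_class S R v" "w \<in> words S" "Z = word_class S R w"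
    by (auto simp: presented_group_carrier)
  then show "X \<otimes>\<^bsub>presented_group S R\<^esub> Y \<otimes>\<^bsub>presented_group S R\<^esub> Z =
      X \<otimes>\<^bsub>presented_group S R\<^esub> (Y \<otimes>\<^bsub>presented_group S R\<^esub> Z)"
    by (simp add: presented_group_mult)
qed

lemma word_eval_closed:
  assumes "group G" "f \<in> S \<rightarrow> carrier G" "w \<in> words S"
  shows "word_eval G f w \<in> carrier G"
proof -
  interpret group G by fact
  show ?thesis using assms(3,2) by (induction w) (auto simp: Pi_iff)
qed

lemma word_eval_append:
  assumes "group G" "f \<in> S \<rightarrow> carrier G" "u \<in> words S" "v \<in> words S"
  shows "word_eval G f (u @ v) = word_eval G f u \<otimes>\<^bsub>G\<^esub> word_eval G f v"
proof -
  interpret group G by fact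
  show ?thesis using assms(3)
  proof (induction u)
    case Nil
    then show ?case using word_eval_closed[OF assms(1,2,4)] by simp
  next
    case (Cons x u)
    then show ?case
      using word_eval_closed[OF assms(1,2,4)] word_eval_closed[OF assms(1,2), of u] assms(2)
      by (auto simp: Pi_iff m_assoc)
  qed
qed

lemma word_eval_eq:
  assumes "group G" "f \<in> S \<rightarrow> carrier G"
    and R: "\<And>l r. (l, r) \<in> R \<Longrightarrow> word_eval G f l = word_eval G f r"
    and "word_eq S R u v"
  shows "word_eval G f u = word_eval G f v"
proof -
  interpret group G by fact
  show ?thesis using assms(4)
  proof (induction rule: word_eq.induct)
    case (cancel a u v b)
    have "f a \<in> carrier G" using cancel assms(2) by auto
    then have "word_eval G f [(a, b), (a, \<not> b)] = \<one>\<^bsub>G\<^esub>" by auto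
    moreover have "[(a, b), (a, \<not> b)] \<in> words S" using cancel by simp
    ultimately show ?case
      using cancel word_eval_closed[OF assms(1,2)]
      by (simp only: word_eval_append[OF assms(1,2)] words_simps) simp
  next
    case (rel l r u v)
    then show ?case by (simp add: word_eval_append[OF assms(1,2)] R)
  qed auto
qed

lemma presented_lift_class:
  assumes "group G" "f \<in> S \<rightarrow> carrier G"
    and "\<And>l r. (l, r) \<in> R \<Longrightarrow> word_eval G f l = word_eval G f r"
    and "w \<in> words S"
  shows "presented_lift G f (word_class S R w) = word_eval G f w"
proof -
  have "word_eval G f ` word_class S R w = {word_eval G f w}"
    using word_eval_eq[OF assms(1-3)] word_eq.refl[OF assms(4)]
    by (auto simp: word_rel_def)
  then show ?thesis by (simp add: presented_lift_def)
qed

lemma presented_lift_hom: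
  assumes "group G" "f \<in> S \<rightarrow> carrier G"
    and "\<And>l r. (l, r) \<in> R \<Longrightarrow> word_eval G f l = word_eval G f r"
  shows "presented_lift G f \<in> hom (presented_group S R) G"
  by (rule homI)
     (auto simp: presented_group_carrier presented_group_mult presented_lift_class[OF assms]
       word_eval_append[OF assms(1,2)] word_eval_closed[OF assms(1,2)])


section \<open>Braid groups\<close>

text \<open>Everything is indexed by the number \<open>m\<close> of strands, so the generators of \<open>Br\<^sub>m\<close> are
  \<open>s\<^sub>1, \<dots>, s\<^sub>m\<^sub>-\<^sub>1\<close>.\<close>

definition pos_word :: "'a list \<Rightarrow> 'a gword" where
  "pos_word w = map (\<lambda>a. (a, True)) w"

definition braid_gens :: "nat \<Rightarrow> nat set" where
  "braid_gens m = {1..<m}"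

definition braid_rels :: "nat \<Rightarrow> (nat gword \<times> nat gword) set" where
  "braid_rels m =
     {(pos_word [i, j], pos_word [j, i]) | i j.
        i \<in> braid_gens m \<and> j \<in> braid_gens m \<and> (i + 2 \<le> j \<or> j + 2 \<le> i)} \<union>
     {(pos_word [i, i + 1, i], pos_word [i + 1, i, i + 1]) | i.
        i \<in> braid_gens m \<and> i + 1 \<in> braid_gens m}"

definition braid_group :: "nat \<Rightarrow> nat gword set monoid" where
  "braid_group m = presented_group (braid_gens m) (braid_rels m)"

definition pos_braid :: "nat \<Rightarrow> nat list \<Rightarrow> nat gword set" where
  "pos_braid m w = word_class (braid_gens m) (braid_rels m) (pos_word w)"

definition braid_perm :: "nat \<Rightarrow> nat gword set \<Rightarrow> (nat \<Rightarrow> nat)" where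
  "braid_perm m = presented_lift (sym_group m) (\<lambda>i. transpose i (i + 1))"

definition pure_braid_group :: "nat \<Rightarrow> nat gword set set" where
  "pure_braid_group m = kernel (braid_group m) (sym_group m) (braid_perm m)"

lemma braid_group_is_group: "group (braid_group m)"
  by (simp add: braid_group_def presented_group_is_group)

lemma transpose_in_sym_group:
  "(\<lambda>i. transpose i (i + 1)) \<in> braid_gens m \<rightarrow> carrier (sym_group m)"
  by (auto simp: braid_gens_def sym_group_carrier intro!: permutes_swap_id)

lemma braid_rels_sym_group:
  assumes "(l, r) \<in> braid_rels m"
  shows "word_eval (sym_group m) (\<lambda>i. transpose i (i + 1)) l =
         word_eval (sym_group m) (\<lambda>i. transpose i (i + 1)) r"
proof -
  have comm: "transpose i (i + 1) \<circ> transpose j (j + 1) = transpose j (j + 1) \<circ> transpose i (i + 1)"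
    if "i + 2 \<le> j" for i j :: nat
    using that by (intro ext) (simp add: transpose_def)
  have braid: "transpose i (i + 1) \<circ> (transpose (i + 1) (i + 2) \<circ> transpose i (i + 1)) =
      transpose (i + 1) (i + 2) \<circ> (transpose i (i + 1) \<circ> transpose (i + 1) (i + 2))" for i :: nat
    by (intro ext) (simp add: transpose_def)
  from assms consider
      (1) i j where "l = pos_word [i, j]" "r = pos_word [j, i]" "i + 2 \<le> j \<or> j + 2 \<le> i"
    | (2) i where "l = pos_word [i, i + 1, i]" "r = pos_word [i + 1, i, i + 1]"
    unfolding braid_rels_def by blast
  then show ?thesis
  proof cases
    case 1
    then show ?thesis using comm[of i j] comm[of j i]
      by (auto simp: pos_word_def sym_group_def)
  next
    case 2
    then show ?thesis using braid[of i] by (simp add: pos_word_def sym_group_def)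
  qed
qed

lemma braid_perm_hom: "braid_perm m \<in> hom (braid_group m) (sym_group m)"
  unfolding braid_perm_def braid_group_def
  by (rule presented_lift_hom[OF sym_group_is_group transpose_in_sym_group braid_rels_sym_group])

lemma braid_perm_gen:
  assumes "1 \<le> i" "i < m"
  shows "braid_perm m (pos_braid m [i]) = transpose i (i + 1)"
proof -
  have "pos_word [i] \<in> words (braid_gens m)"
    using assms by (simp add: pos_word_def braid_gens_def)
  from presented_lift_class[OF sym_group_is_group transpose_in_sym_group braid_rels_sym_group this]
  show ?thesis
    by (simp add: braid_perm_def pos_braid_def pos_word_def sym_group_def)
qed

text \<open>The word \<open>(s\<^sub>i) (s\<^sub>i\<^sub>+\<^sub>1 s\<^sub>i) \<dots> (s\<^sub>j s\<^sub>j\<^sub>-\<^sub>1 \<dots> s\<^sub>i)\<close>.\<close>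

definition ell_word :: "nat \<Rightarrow> nat \<Rightarrow> nat list" where
  "ell_word i j = concat (map (\<lambda>k. rev [i..<k + 1]) [i..<j + 1])"

lemma "ell_word 2 4 = [2, 3, 2, 4, 3, 2]"
  by (simp add: ell_word_def upt_conv_Cons)

definition ell :: "nat \<Rightarrow> nat \<Rightarrow> nat \<Rightarrow> nat gword set" where
  "ell m i j = pos_braid m (ell_word i j)"


section \<open>Connected subgraphs of the Dynkin graph of type A\<close>

text \<open>An undirected edge is represented by the two opposite arcs.\<close>

definition dynkin_A :: "nat \<Rightarrow> nat pair_pre_digraph" where
  "dynkin_A n = \<lparr> pverts = {1..n},
     parcs = {(i, j). i \<in> {1..n} \<and> j \<in> {1..n} \<and> (j = i + 1 \<or> i = j + 1)} \<rparr>"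

text \<open>Subgraphs are full (induced); \<^const>\<open>connected\<close> includes nonemptiness.\<close>

definition connected_subgraphs_A :: "nat \<Rightarrow> (nat, nat \<times> nat) pre_digraph set" where
  "connected_subgraphs_A n = {A. induced_subgraph A (with_proj (dynkin_A n)) \<and> connected A}"

text \<open>The vertex set of a connected \<open>A\<close> is the interval from its least to its greatest node
  (see \<open>connected_subgraphs_A_verts\<close>).\<close>

definition ell_subgraph :: "nat \<Rightarrow> (nat, nat \<times> nat) pre_digraph \<Rightarrow> nat gword set" where
  "ell_subgraph m A = ell m (Min (verts A)) (Max (verts A))"

lemma connected_subgraphs_A_arcs_ends:
  assumes "induced_subgraph A (with_proj (dynkin_A n))"
  shows "arcs_ends (with_proj (mk_symmetric A)) =
    {(i, j). i \<in> verts A \<and> j \<in> verts A \<and> (j = i + 1 \<or> i = j + 1)}"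
proof -
  have *: "verts A \<subseteq> {1..n}" "tail A = fst" "head A = snd"
    "arcs A = {e \<in> parcs (dynkin_A n). fst e \<in> verts A \<and> snd e \<in> verts A}"
    using assms by (auto simp: induced_subgraph_def subgraph_def compatible_def dynkin_A_def)
  show ?thesis
    using *(1) unfolding mk_symmetric_def *(2-4) by (fastforce simp: dynkin_A_def)
qed

lemma connected_subgraphs_A_verts:
  "verts ` connected_subgraphs_A n = {{i..j} | i j. 1 \<le> i \<and> i \<le> j \<and> j \<le> n}"
proof (intro equalityI subsetI)
  fix V assume "V \<in> verts ` connected_subgraphs_A n"
  then obtain A where A: "V = verts A" "induced_subgraph A (with_proj (dynkin_A n))" "connected A"
    by (auto simp: connected_subgraphs_A_def)
  define E where "E = {(i, j). i \<in> V \<and> j \<in> V \<and> (j = i + 1 \<or> i = j + 1)}"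
  have V: "V \<subseteq> {1..n}" "V \<noteq> {}"
    using A by (auto simp: induced_subgraph_def subgraph_def dynkin_A_def connected_def
        strongly_connected_def mk_symmetric_def)
  have fin: "finite V" using V(1) finite_subset by blast
  have conn: "(u, v) \<in> E\<^sup>*" if "u \<in> V" "v \<in> V" for u v
    using A(3) that reachable_rtranclI[of "with_proj (mk_symmetric A)" u v]
    unfolding connected_subgraphs_A_arcs_ends[OF A(2)] connected_def strongly_connected_def
    by (auto simp: E_def A(1) mk_symmetric_def)
  have between: "k \<in> V" if "(u, v) \<in> E\<^sup>*" "u \<in> V" "u \<le> k" "k \<le> v" for u v k
    using that
  proof (induction arbitrary: k rule: rtrancl_induct)
    case base
    then show ?case by auto
  next
    case (step y z)
    then show ?case by (cases "k \<le> y") (auto simp: E_def le_Suc_eq)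
  qed
  have mm: "Min V \<in> V" "Max V \<in> V"
    using V fin by simp_all
  have "V = {Min V..Max V}"
  proof (intro equalityI subsetI)
    fix k assume "k \<in> {Min V..Max V}"
    then show "k \<in> V" using between[OF conn[OF mm] mm(1), of k] by simp
  qed (use fin in simp)
  moreover have "1 \<le> Min V" "Min V \<le> Max V" "Max V \<le> n"
    using V(1) mm fin by auto
  ultimately show "V \<in> {{i..j} | i j. 1 \<le> i \<and> i \<le> j \<and> j \<le> n}"
    by blast
next
  fix V assume "V \<in> {{i..j} | i j. 1 \<le> i \<and> i \<le> j \<and> j \<le> n}"
  then obtain i j where ij: "V = {i..j}" "1 \<le> i" "i \<le> j" "j \<le> n" by auto
  define A where "A = with_proj \<lparr> pverts = V,
    parcs = {(i, j). i \<in> V \<and> j \<in> V \<and> (j = i + 1 \<or> i = j + 1)} \<rparr>"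
  have ind: "induced_subgraph A (with_proj (dynkin_A n))"
    using ij by (auto simp: A_def induced_subgraph_def subgraph_def dynkin_A_def wf_digraph_def)
  have VA: "verts (with_proj (mk_symmetric A)) = V" "verts A = V"
    by (simp_all add: A_def mk_symmetric_def)
  define E where "E = {(i, j). i \<in> V \<and> j \<in> V \<and> (j = i + 1 \<or> i = j + 1)}"
  have ends: "arcs_ends (with_proj (mk_symmetric A)) = E"
    unfolding connected_subgraphs_A_arcs_ends[OF ind] by (simp add: VA E_def)
  have up: "i \<le> a \<Longrightarrow> a \<le> b \<Longrightarrow> b \<le> j \<Longrightarrow> (a, b) \<in> rtrancl_on V E" for a b
  proof (induction b)
    case 0
    then show ?case by (auto simp: ij(1))
  next
    case (Suc b)
    show ?case
    proof (cases "a = Suc b")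
      case True
      then show ?thesis using Suc.prems by (auto simp: ij(1))
    next
      case False
      then have "(a, b) \<in> rtrancl_on V E" using Suc by simp
      moreover have "(b, Suc b) \<in> E" using Suc.prems False by (auto simp: E_def ij(1))
      moreover have "Suc b \<in> V" using Suc.prems ij by simp
      ultimately show ?thesis by (rule rtrancl_on_into_rtrancl_on)
    qed
  qed
  have "sym E" by (auto simp: E_def sym_def)
  then have "sym (rtrancl_on V E)" by (rule rtrancl_on_sym)
  then have "(a, b) \<in> rtrancl_on V E" if "a \<in> V" "b \<in> V" for a b
    using that up[of a b] up[of b a] by (cases "a \<le> b") (auto simp: ij(1) dest: symD)
  then have "connected A"
    using ij unfolding connected_def strongly_connected_def reachable_def ends VA by auto
  then show "V \<in> verts ` connected_subgraphs_A n"
    using ind VA(2) by (force simp: connected_subgraphs_A_def)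
qed

end

(*
  Write D(i,j) for the square of ell(i,j). It is central in the parabolic subgroup of s_i, ..., s_j,
  and D(i,j) = D(i,j-1) P(i,j) with the palindrome P(i,j) = s_j ... s_i s_i ... s_j. Since
  s_{j+1} P(i,j) s_{j+1} = P(i,j+1), conjugating D(i,j) by s_{j+1} gives, up to the square of s_{j+1},
    D(i,j-1) P(i,j+1) = D(i,j-1) D(i,j)^{-1} D(i,j+1),
  and symmetrically for s_{i-1}. So the subgroup H generated by the D(i,j) is normal. It contains every
  s_i^2 = D(i,i), so the quotient by H satisfies the Coxeter relations of the symmetric group; as these
  present the symmetric group, the kernel of the permutation map lies in H.
*)

theory Submission
  imports Defs
begin

text \<open>Centrality of D(i,j) cannot be read off from D(i,j-1) P(i,j) alone, since this splitting
  says nothing about the top generator s_j. A second factorization takes care of it: D(i,j) =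
  D(i+1,j) s_i ... s_j s_j ... s_i, where the other palindrome misses only the bottom generator s_i.
  The same factorization is what "symmetrically" rests on for conjugation by s_{i-1}.

  "Up to the square" is a device as well: s x s is used in place of s x s^{-1}, so that every
  identity between twists is one between positive words and follows by moving single letters.
  Inverses enter only through the group operations.

  From the presentation of the symmetric group only injectivity is used: a word with trivial
  permutation reduces to the empty word under the Coxeter relations. It follows from a coset normal
  form, by induction on the number of generators.\<close>

section \<open>Reversal of words and enlargement of the set of relations\<close>

lemma pos_word_simps [simp]:
  "pos_word [] = []"
  "pos_word (a # u) = (a, True) # pos_word u"
  "pos_word (u @ v) = pos_word u @ pos_word v"
  "rev (pos_word u) = pos_word (rev u)"
  by (simp_all add: pos_word_def rev_map)

lemma pos_word_words [simp]: "pos_word u \<in> words S \<longleftrightarrow> set u \<subseteq> S"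
  by (auto simp: pos_word_def words_def)

text \<open>Letters keep their sign, so this is the mirror anti-automorphism and not inversion. A
  cancelling pair read backwards is again one, with the sign \<open>b\<close> flipped. It turns
  identities about ascending runs into identities about descending ones.\<close>

lemma word_eq_rev:
  assumes "\<And>l r. (l, r) \<in> R \<Longrightarrow> (rev l, rev r) \<in> R" and "word_eq S R u v"
  shows "word_eq S R (rev u) (rev v)"
proof -
  have rev_words: "rev w \<in> words S" if "w \<in> words S" for w :: "'a gword"
    using that by (simp add: words_def in_lists_conv_set)
  show ?thesis using assms(2)
  proof (induction rule: word_eq.induct)
    case (cancel a u v b)
    then show ?case using word_eq.cancel[of a S "rev v" "rev u" R "\<not> b"] by (simp add: rev_words)
  next
    case (rel l r u v)
    then show ?case
      using word_eq.rel[OF assms(1)[OF rel(1)], of S "rev v" "rev u"] by (simp add: rev_words)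
  qed (auto intro: word_eq.refl word_eq.sym word_eq.trans rev_words)
qed

lemma word_eq_mono:
  assumes "R \<subseteq> R'" "word_eq S R u v"
  shows "word_eq S R' u v"
  using assms(2)
proof (induction rule: word_eq.induct)
  case (rel l r u v)
  then show ?case using assms(1) by (intro word_eq.rel) auto
next
  case (cancel a u v b)
  then show ?case by (rule word_eq.cancel)
qed (auto intro: word_eq.refl word_eq.sym word_eq.trans)

section \<open>Positive words\<close>

text \<open>Equality in the braid group, not in the positive braid monoid: intermediate words may
  contain inverse letters.\<close>

definition pos_eq :: "nat \<Rightarrow> nat list \<Rightarrow> nat list \<Rightarrow> bool" where
  "pos_eq m u v \<longleftrightarrow> word_eq (braid_gens m) (braid_rels m) (pos_word u) (pos_word v)"

lemma pos_eq_refl: "set u \<subseteq> {1..<m} \<Longrightarrow> pos_eq m u u"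
  by (simp add: pos_eq_def word_eq.refl braid_gens_def)

lemma pos_eq_sym: "pos_eq m u v \<Longrightarrow> pos_eq m v u"
  by (simp add: pos_eq_def word_eq.sym)

lemma pos_eq_trans [trans]: "pos_eq m u v \<Longrightarrow> pos_eq m v w \<Longrightarrow> pos_eq m u w"
  unfolding pos_eq_def by (rule word_eq.trans)

lemma pos_eq_append: "pos_eq m u u' \<Longrightarrow> pos_eq m v v' \<Longrightarrow> pos_eq m (u @ v) (u' @ v')"
  by (simp add: pos_eq_def word_eq_append)

lemma pos_eq_cong:
  "pos_eq m u v \<Longrightarrow> set a \<subseteq> {1..<m} \<Longrightarrow> set b \<subseteq> {1..<m} \<Longrightarrow> pos_eq m (a @ u @ b) (a @ v @ b)"
  by (intro pos_eq_append pos_eq_refl)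

lemma pos_eq_rev: "pos_eq m u v \<Longrightarrow> pos_eq m (rev u) (rev v)"
  using word_eq_rev[of "braid_rels m" "braid_gens m" "pos_word u" "pos_word v"]
  unfolding pos_eq_def by (fastforce simp: braid_rels_def)

lemma pos_eq_far:
  assumes "i \<in> {1..<m}" "j \<in> {1..<m}" "i + 2 \<le> j \<or> j + 2 \<le> i"
  shows "pos_eq m [i, j] [j, i]"
proof -
  have "(pos_word [i, j], pos_word [j, i]) \<in> braid_rels m"
    using assms unfolding braid_rels_def braid_gens_def by blast
  from word_eq.rel[OF this, of "braid_gens m" "[]" "[]"] assms show ?thesis
    by (simp add: pos_eq_def braid_gens_def)
qed

lemma pos_eq_braid:
  assumes "1 \<le> i" "Suc i < m"
  shows "pos_eq m [i, Suc i, i] [Suc i, i, Suc i]"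
proof -
  have "(pos_word [i, Suc i, i], pos_word [Suc i, i, Suc i]) \<in> braid_rels m"
    using assms unfolding braid_rels_def braid_gens_def by force
  from word_eq.rel[OF this, of "braid_gens m" "[]" "[]"] assms show ?thesis
    by (simp add: pos_eq_def braid_gens_def)
qed

section \<open>Moving letters across runs and palindromes\<close>

text \<open>The letters of \<open>w\<close> cross \<open>u\<close> one at a time, each replaced by
  its image under \<open>f\<close>. Commutation is the case \<open>f = id\<close>; half twists are
  shifted with the successor and the predecessor.\<close>

lemma pos_eq_intertwine:
  assumes "set u \<subseteq> {1..<m}" "set w \<subseteq> {1..<m}" "f ` set w \<subseteq> {1..<m}"
    and "\<And>k. k \<in> set w \<Longrightarrow> pos_eq m (u @ [k]) ([f k] @ u)"
  shows "pos_eq m (u @ w) (map f w @ u)"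
  using assms(2-)
proof (induction w)
  case Nil
  then show ?case using assms(1) by (simp add: pos_eq_refl)
next
  case (Cons k w)
  have "pos_eq m ((u @ [k]) @ w) (([f k] @ u) @ w)"
    using Cons.prems by (intro pos_eq_append[of m "u @ [k]"] Cons.prems(3) pos_eq_refl) auto
  also have "pos_eq m (([f k] @ u) @ w) ([f k] @ map f w @ u)"
    unfolding append_assoc using Cons.prems
    by (intro pos_eq_append[OF pos_eq_refl Cons.IH]) auto
  finally show ?case by simp
qed

lemma pos_eq_commute:
  assumes "set u \<subseteq> {1..<m}" "set w \<subseteq> {1..<m}"
    and "\<And>k. k \<in> set w \<Longrightarrow> pos_eq m (u @ [k]) ([k] @ u)"
  shows "pos_eq m (u @ w) (w @ u)"
  using pos_eq_intertwine[of u m w id] assms by simp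

lemma pos_eq_commute_far:
  assumes "k \<in> {1..<m}" "set w \<subseteq> {1..<m}" "\<And>i. i \<in> set w \<Longrightarrow> i + 2 \<le> k \<or> k + 2 \<le> i"
  shows "pos_eq m ([k] @ w) (w @ [k])"
  by (rule pos_eq_commute) (use assms in \<open>force intro!: pos_eq_far\<close>)+

text \<open>The letter k commutes with everything above k+1, the braid relation turns k (k+1) k into
  (k+1) k (k+1), and the leading k+1 commutes with everything below k.\<close>

lemma ascending_shift:
  assumes "1 \<le> i" "i \<le> k" "k < j" "j < m"
  shows "pos_eq m ([i..<Suc j] @ [k]) ([Suc k] @ [i..<Suc j])"
proof -
  have "[i..<Suc j] = [i..<k] @ [k..<Suc j]"
    using assms upt_add_eq_append[of i k "Suc j - k"] by simp
  also have "[k..<Suc j] = [k, Suc k] @ [k + 2..<Suc j]"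
    using assms by (simp add: upt_conv_Cons)
  finally have split: "[i..<Suc j] = [i..<k] @ [k, Suc k] @ [k + 2..<Suc j]" .
  have "pos_eq m ([k + 2..<Suc j] @ [k]) ([k] @ [k + 2..<Suc j])"
    using assms by (intro pos_eq_sym[OF pos_eq_commute_far]) auto
  then have "pos_eq m (([i..<k] @ [k, Suc k]) @ ([k + 2..<Suc j] @ [k]) @ [])
      (([i..<k] @ [k, Suc k]) @ ([k] @ [k + 2..<Suc j]) @ [])"
    using assms by (intro pos_eq_cong) auto
  also have "\<dots> = [i..<k] @ [k, Suc k, k] @ [k + 2..<Suc j]" by simp
  also have "pos_eq m \<dots> ([i..<k] @ [Suc k, k, Suc k] @ [k + 2..<Suc j])"
    using assms by (intro pos_eq_cong pos_eq_braid) auto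
  also have "\<dots> = [] @ ([i..<k] @ [Suc k]) @ [k, Suc k] @ [k + 2..<Suc j]" by simp
  also have "pos_eq m \<dots> ([] @ ([Suc k] @ [i..<k]) @ [k, Suc k] @ [k + 2..<Suc j])"
    using assms by (intro pos_eq_cong pos_eq_sym[OF pos_eq_commute_far]) auto
  finally show ?thesis unfolding split by simp
qed

lemma descending_shift:
  assumes "1 \<le> i" "i \<le> k" "k < j" "j < m"
  shows "pos_eq m (rev [i..<Suc j] @ [Suc k]) ([k] @ rev [i..<Suc j])"
  using pos_eq_sym[OF pos_eq_rev[OF ascending_shift[OF assms]]] by simp

text \<open>The ascending half raises the index of the crossing letter and the descending half
  lowers it again. The top generator s_j is out of reach because its index cannot be raised inside
  the run.\<close>

lemma desc_asc_commute:
  assumes "1 \<le> i" "i \<le> k" "k < j" "j < m"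
  shows "pos_eq m ((rev [i..<Suc j] @ [i..<Suc j]) @ [k]) ([k] @ rev [i..<Suc j] @ [i..<Suc j])"
proof -
  have "pos_eq m (rev [i..<Suc j] @ ([i..<Suc j] @ [k]) @ [])
      (rev [i..<Suc j] @ ([Suc k] @ [i..<Suc j]) @ [])"
    using assms by (intro pos_eq_cong ascending_shift) auto
  also have "\<dots> = [] @ (rev [i..<Suc j] @ [Suc k]) @ [i..<Suc j]" by simp
  also have "pos_eq m \<dots> ([] @ ([k] @ rev [i..<Suc j]) @ [i..<Suc j])"
    using assms by (intro pos_eq_cong descending_shift) auto
  finally show ?thesis by simp
qed

text \<open>Here the index is lowered first and raised afterwards, so it is the bottom generator s_i
  that is left out.\<close>

lemma asc_desc_commute:
  assumes "1 \<le> i" "i \<le> k" "k < j" "j < m"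
  shows "pos_eq m (([i..<Suc j] @ rev [i..<Suc j]) @ [Suc k])
    ([Suc k] @ [i..<Suc j] @ rev [i..<Suc j])"
proof -
  have "pos_eq m ([i..<Suc j] @ (rev [i..<Suc j] @ [Suc k]) @ [])
      ([i..<Suc j] @ ([k] @ rev [i..<Suc j]) @ [])"
    using assms by (intro pos_eq_cong descending_shift) auto
  also have "\<dots> = [] @ ([i..<Suc j] @ [k]) @ rev [i..<Suc j]" by simp
  also have "pos_eq m \<dots> ([] @ ([Suc k] @ [i..<Suc j]) @ rev [i..<Suc j])"
    using assms by (intro pos_eq_cong ascending_shift) auto
  finally show ?thesis by simp
qed

section \<open>Half twists and full twists\<close>

text \<open>The upper bound is exclusive, unlike in \<^const>\<open>ell_word\<close>, so that \<open>half_twist i i\<close> is the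
  empty word.\<close>

definition half_twist :: "nat \<Rightarrow> nat \<Rightarrow> nat list" where
  "half_twist i j = concat (map (\<lambda>k. rev [i..<Suc k]) [i..<j])"

text \<open>In the notation of the overview this is D(i, j-1), the full twist of the strands i, ...,
  j.\<close>

definition full_twist :: "nat \<Rightarrow> nat \<Rightarrow> nat list" where
  "full_twist i j = half_twist i j @ half_twist i j"

lemma ell_word_half_twist: "ell_word i j = half_twist i (Suc j)"
  by (simp add: ell_word_def half_twist_def)

lemma half_twist_refl [simp]: "half_twist i i = []"
  by (simp add: half_twist_def)

lemma full_twist_refl [simp]: "full_twist i i = []"
  by (simp add: full_twist_def)

lemma half_twist_Suc: "i \<le> j \<Longrightarrow> half_twist i (Suc j) = half_twist i j @ rev [i..<Suc j]"
  by (simp add: half_twist_def)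

lemma full_twist_single: "full_twist i (Suc i) = [i, i]"
  by (simp add: full_twist_def half_twist_Suc)

lemma set_half_twist: "set (half_twist i j) \<subseteq> {i..<j}"
  by (auto simp: half_twist_def)

lemma set_full_twist: "set (full_twist i j) \<subseteq> {i..<j}"
  using set_half_twist by (auto simp: full_twist_def)

lemma set_half_twist_gens: "1 \<le> i \<Longrightarrow> j \<le> m \<Longrightarrow> set (half_twist i j) \<subseteq> {1..<m}"
  using set_half_twist[of i j] by auto

lemma set_full_twist_gens: "1 \<le> i \<Longrightarrow> j \<le> m \<Longrightarrow> set (full_twist i j) \<subseteq> {1..<m}"
  using set_full_twist[of i j] by auto

lemma map_Suc_half_twist: "map Suc (half_twist i j) = half_twist (Suc i) (Suc j)"
proof -
  have "map Suc (half_twist i j) = concat (map (\<lambda>k. rev (map Suc [i..<Suc k])) [i..<j])"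
    by (simp add: half_twist_def map_concat comp_def rev_map)
  also have "\<dots> = concat (map (\<lambda>k. rev [Suc i..<Suc k]) (map Suc [i..<j]))"
    by (simp only: map_Suc_upt[symmetric] map_map comp_def)
  finally show ?thesis by (simp only: half_twist_def map_Suc_upt)
qed

text \<open>The top letter of the last descending block is at distance at least 2 from all letters
  of the half twist two steps shorter. It therefore slides left across that twist and extends the
  ascending run already pulled to the front.\<close>

lemma half_twist_ascending:
  assumes "1 \<le> i" "i \<le> j" "j < m"
  shows "pos_eq m (half_twist i (Suc j)) ([i..<Suc j] @ half_twist i j)"
  using assms(2,3)
proof (induction j rule: dec_induct)
  case base
  then show ?case using assms(1) by (simp add: half_twist_Suc pos_eq_refl)
next
  case (step j)
  have "half_twist i (Suc (Suc j)) = [] @ half_twist i (Suc j) @ rev [i..<Suc (Suc j)]"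
    using step by (simp add: half_twist_Suc)
  also have "pos_eq m \<dots> ([] @ ([i..<Suc j] @ half_twist i j) @ rev [i..<Suc (Suc j)])"
    using step assms(1) by (intro pos_eq_cong) auto
  also have "\<dots> = [i..<Suc j] @ (half_twist i j @ [Suc j]) @ rev [i..<Suc j]"
    using step by simp
  also have "pos_eq m \<dots> ([i..<Suc j] @ ([Suc j] @ half_twist i j) @ rev [i..<Suc j])"
    using step assms(1) set_half_twist[of i j]
    by (intro pos_eq_cong pos_eq_sym[OF pos_eq_commute_far]) auto
  finally show ?case using step by (simp add: half_twist_Suc)
qed

text \<open>Write the first half twist with its descending run at the end and the second with an
  ascending run in front. The two runs meet in a palindrome, which commutes with the shorter half
  twist on its right.\<close>

lemma full_twist_Suc:
  assumes "1 \<le> i" "i \<le> j" "j < m"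
  shows "pos_eq m (full_twist i (Suc j)) (full_twist i j @ rev [i..<Suc j] @ [i..<Suc j])"
proof -
  note gens = set_half_twist_gens[of i j m]
  have "full_twist i (Suc j) = (half_twist i j @ rev [i..<Suc j]) @ half_twist i (Suc j) @ []"
    using assms by (simp add: full_twist_def half_twist_Suc)
  also have "pos_eq m \<dots> ((half_twist i j @ rev [i..<Suc j]) @ ([i..<Suc j] @ half_twist i j) @ [])"
    using assms gens by (intro pos_eq_cong half_twist_ascending) auto
  also have "\<dots> = half_twist i j @ ((rev [i..<Suc j] @ [i..<Suc j]) @ half_twist i j) @ []"
    by simp
  also have "pos_eq m \<dots> (half_twist i j @ (half_twist i j @ rev [i..<Suc j] @ [i..<Suc j]) @ [])"
  proof (rule pos_eq_cong, rule pos_eq_commute)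
    fix k assume "k \<in> set (half_twist i j)"
    then have "i \<le> k" "k < j" using set_half_twist[of i j] by auto
    then show "pos_eq m ((rev [i..<Suc j] @ [i..<Suc j]) @ [k]) ([k] @ rev [i..<Suc j] @ [i..<Suc j])"
      using assms by (intro desc_asc_commute) auto
  qed (use assms gens in auto)
  finally show ?thesis by (simp add: full_twist_def)
qed

text \<open>Crossing a run shifts the shorter half twist by one index. Hence the half twist is also
  the shifted one followed by an ascending run, or preceded by a descending run. Multiplying these
  two forms puts the palindrome in the middle, and it commutes with the shifted half twist.\<close>

lemma full_twist_Suc_left:
  assumes "1 \<le> i" "i \<le> j" "j < m"
  shows "pos_eq m (full_twist i (Suc j))
    (full_twist (Suc i) (Suc j) @ [i..<Suc j] @ rev [i..<Suc j])"
proof -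
  let ?h = "half_twist (Suc i) (Suc j)"
  note gens = set_half_twist_gens[of i j m] set_half_twist_gens[of "Suc i" "Suc j" m]
  have "pos_eq m ([i..<Suc j] @ half_twist i j) (map Suc (half_twist i j) @ [i..<Suc j])"
    using assms set_half_twist[of i j]
    by (intro pos_eq_intertwine ascending_shift) force+
  with half_twist_ascending[OF assms]
  have asc: "pos_eq m (half_twist i (Suc j)) (?h @ [i..<Suc j])"
    unfolding map_Suc_half_twist by (rule pos_eq_trans)
  have "pos_eq m (rev [i..<Suc j] @ ?h) (map (\<lambda>k. k - 1) ?h @ rev [i..<Suc j])"
  proof (rule pos_eq_intertwine)
    fix k assume "k \<in> set ?h"
    then have "k = Suc (k - 1)" "i \<le> k - 1" "k - 1 < j"
      using set_half_twist[of "Suc i" "Suc j"] by force+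
    then show "pos_eq m (rev [i..<Suc j] @ [k]) ([k - 1] @ rev [i..<Suc j])"
      using descending_shift[of i "k - 1" j m] assms by simp
  qed (use assms set_half_twist[of "Suc i" "Suc j"] in force)+
  also have "map (\<lambda>k. k - 1) ?h = half_twist i j"
    by (simp add: map_Suc_half_twist[symmetric] comp_def)
  finally have desc: "pos_eq m (half_twist i (Suc j)) (rev [i..<Suc j] @ ?h)"
    using assms by (simp only: half_twist_Suc pos_eq_sym)
  have "pos_eq m (full_twist i (Suc j)) ((?h @ [i..<Suc j]) @ rev [i..<Suc j] @ ?h)"
    unfolding full_twist_def by (rule pos_eq_append[OF asc desc])
  also have "\<dots> = ?h @ (([i..<Suc j] @ rev [i..<Suc j]) @ ?h) @ []" by simp
  also have "pos_eq m \<dots> (?h @ (?h @ [i..<Suc j] @ rev [i..<Suc j]) @ [])"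
  proof (rule pos_eq_cong, rule pos_eq_commute)
    fix k assume "k \<in> set ?h"
    then have "k = Suc (k - 1)" "i \<le> k - 1" "k - 1 < j"
      using set_half_twist[of "Suc i" "Suc j"] by force+
    then show "pos_eq m (([i..<Suc j] @ rev [i..<Suc j]) @ [k]) ([k] @ [i..<Suc j] @ rev [i..<Suc j])"
      using asc_desc_commute[of i "k - 1" j m] assms by simp
  qed (use assms gens in auto)
  finally show ?thesis by (simp add: full_twist_def)
qed

text \<open>If k is below the top generator, split off the palindrome at the top; if k is the top
  generator, split off the one at the bottom. In both cases the palindrome commutes with s_k and the
  remaining twist is shorter but still involves s_k. The induction ends at the square of a single
  generator.\<close>

lemma full_twist_commute:
  assumes "1 \<le> i" "i \<le> k" "k < j" "j \<le> m"
  shows "pos_eq m (full_twist i j @ [k]) ([k] @ full_twist i j)"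
  using assms
proof (induction "j - i" arbitrary: i j rule: less_induct)
  case less
  obtain j' where j: "j = Suc j'" using less.prems by (cases j) auto
  have k: "k \<in> {1..<m}" using less.prems by auto
  have step: "pos_eq m (full_twist i j @ [k]) ([k] @ full_twist i j)"
    if eq: "pos_eq m (full_twist i j) (a @ p)"
      and a: "pos_eq m (a @ [k]) ([k] @ a)" and p: "pos_eq m (p @ [k]) ([k] @ p)"
      and gens: "set a \<subseteq> {1..<m}" "set p \<subseteq> {1..<m}" for a p
  proof -
    have "pos_eq m (full_twist i j @ [k]) ((a @ p) @ [k])"
      using k by (intro pos_eq_append eq pos_eq_refl) auto
    also have "(a @ p) @ [k] = a @ (p @ [k]) @ []" by simp
    also have "pos_eq m \<dots> (a @ ([k] @ p) @ [])"
      using gens by (intro pos_eq_cong p) auto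
    also have "\<dots> = [] @ (a @ [k]) @ p" by simp
    also have "pos_eq m \<dots> ([] @ ([k] @ a) @ p)"
      using gens by (intro pos_eq_cong a) auto
    also have "\<dots> = [k] @ (a @ p)" by simp
    also have "pos_eq m \<dots> ([k] @ full_twist i j)"
      using k by (intro pos_eq_append pos_eq_sym[OF eq] pos_eq_refl) auto
    finally show ?thesis .
  qed
  consider "i = j'" "k = j'" | "k < j'" | "i < j'" "k = j'"
    using less.prems j by linarith
  then show ?case
  proof cases
    case 1
    then show ?thesis using k by (simp add: j full_twist_single pos_eq_refl)
  next
    case 2
    show ?thesis
    proof (rule step)
      show "pos_eq m (full_twist i j) (full_twist i j' @ rev [i..<Suc j'] @ [i..<Suc j'])"
        unfolding j using less.prems j by (intro full_twist_Suc) auto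
      show "pos_eq m (full_twist i j' @ [k]) ([k] @ full_twist i j')"
        using less.prems j 2 by (intro less.hyps) auto
      show "pos_eq m ((rev [i..<Suc j'] @ [i..<Suc j']) @ [k]) ([k] @ rev [i..<Suc j'] @ [i..<Suc j'])"
        using less.prems j 2 by (intro desc_asc_commute) auto
    qed (use less.prems j set_full_twist_gens in auto)
  next
    case 3
    show ?thesis
    proof (rule step)
      show "pos_eq m (full_twist i j) (full_twist (Suc i) j @ [i..<Suc j'] @ rev [i..<Suc j'])"
        unfolding j using less.prems j by (intro full_twist_Suc_left) auto
      show "pos_eq m (full_twist (Suc i) j @ [k]) ([k] @ full_twist (Suc i) j)"
        using less.prems j 3 by (intro less.hyps) auto
      show "pos_eq m (([i..<Suc j'] @ rev [i..<Suc j']) @ [k]) ([k] @ [i..<Suc j'] @ rev [i..<Suc j'])"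
        using asc_desc_commute[of i "k - 1" j' m] less.prems j 3 by simp
    qed (use less.prems j set_full_twist_gens in auto)
  qed
qed

text \<open>The new letter commutes with the shorter twist, whose letters lie at least 2 below it,
  so the two copies lengthen the palindrome at both ends.\<close>

lemma full_twist_conj_right:
  assumes "1 \<le> i" "i \<le> j" "Suc j < m"
  shows "pos_eq m ([Suc j] @ full_twist i (Suc j) @ [Suc j])
    (full_twist i j @ rev [i..<Suc (Suc j)] @ [i..<Suc (Suc j)])"
proof -
  have "pos_eq m ([Suc j] @ full_twist i (Suc j) @ [Suc j])
      ([Suc j] @ (full_twist i j @ rev [i..<Suc j] @ [i..<Suc j]) @ [Suc j])"
    using assms by (intro pos_eq_cong full_twist_Suc) auto
  also have "\<dots> = [] @ ([Suc j] @ full_twist i j) @ rev [i..<Suc j] @ [i..<Suc (Suc j)]"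
    using assms by simp
  also have "pos_eq m \<dots>
      ([] @ (full_twist i j @ [Suc j]) @ rev [i..<Suc j] @ [i..<Suc (Suc j)])"
    using assms set_full_twist[of i j]
    by (intro pos_eq_cong pos_eq_commute_far) auto
  finally show ?thesis using assms by simp
qed

text \<open>The mirror situation: s_i is adjacent to the bottom of the interval, so the bottom
  palindrome has to be split off for the remaining twist to be far from s_i.\<close>

lemma full_twist_conj_left:
  assumes "1 \<le> i" "Suc i \<le> j" "j < m"
  shows "pos_eq m ([i] @ full_twist (Suc i) (Suc j) @ [i])
    (full_twist (Suc (Suc i)) (Suc j) @ [i..<Suc j] @ rev [i..<Suc j])"
proof -
  have upt: "[i..<Suc j] = i # [Suc i..<Suc j]"
    using assms by (simp add: upt_conv_Cons del: upt_Suc)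
  have "pos_eq m ([i] @ full_twist (Suc i) (Suc j) @ [i])
      ([i] @ (full_twist (Suc (Suc i)) (Suc j) @ [Suc i..<Suc j] @ rev [Suc i..<Suc j]) @ [i])"
    using assms by (intro pos_eq_cong full_twist_Suc_left) auto
  also have "\<dots> = [] @ ([i] @ full_twist (Suc (Suc i)) (Suc j)) @ [Suc i..<Suc j] @ rev [i..<Suc j]"
    unfolding upt by (simp del: upt_Suc)
  also have "pos_eq m \<dots>
      ([] @ (full_twist (Suc (Suc i)) (Suc j) @ [i]) @ [Suc i..<Suc j] @ rev [i..<Suc j])"
    using assms set_full_twist[of "Suc (Suc i)" "Suc j"]
    by (intro pos_eq_cong pos_eq_commute_far) auto
  finally show ?thesis unfolding upt by (simp del: upt_Suc)
qed

section \<open>The Coxeter presentation of the symmetric group\<close>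

definition coxeter_rels :: "nat \<Rightarrow> (nat gword \<times> nat gword) set" where
  "coxeter_rels m = braid_rels m \<union> {(pos_word [i, i], []) | i. i \<in> braid_gens m}"

abbreviation coxeter_eq :: "nat \<Rightarrow> nat gword \<Rightarrow> nat gword \<Rightarrow> bool" where
  "coxeter_eq m \<equiv> word_eq (braid_gens m) (coxeter_rels m)"

abbreviation word_perm :: "nat \<Rightarrow> nat gword \<Rightarrow> nat \<Rightarrow> nat" where
  "word_perm m \<equiv> word_eval (sym_group m) (\<lambda>i. transpose i (i + 1))"

lemma coxeter_eq_pos_eq: "pos_eq m u v \<Longrightarrow> coxeter_eq m (pos_word u) (pos_word v)"
  unfolding pos_eq_def by (erule word_eq_mono[rotated]) (auto simp: coxeter_rels_def)

lemma coxeter_eq_cancel: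
  assumes "i \<in> braid_gens m" "u \<in> words (braid_gens m)" "v \<in> words (braid_gens m)"
  shows "coxeter_eq m (u @ pos_word [i, i] @ v) (u @ v)"
  using word_eq.rel[of "pos_word [i, i]" "[]" "coxeter_rels m" "braid_gens m" u v] assms
  by (auto simp: coxeter_rels_def)

text \<open>Since s_i^2 = 1, an inverse letter equals the positive one; the normal form argument can
  thus be confined to positive words.\<close>

lemma coxeter_eq_pos_word:
  "w \<in> words (braid_gens m) \<Longrightarrow> coxeter_eq m w (pos_word (map fst w))"
proof (induction w)
  case Nil
  then show ?case by (simp add: word_eq.refl)
next
  case (Cons x w)
  obtain a b where x: "x = (a, b)" by fastforce
  have a: "a \<in> braid_gens m" and w: "w \<in> words (braid_gens m)" using Cons.prems x by auto
  have "coxeter_eq m ([(a, b)] @ w) ([(a, True)] @ w)"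
  proof (cases b)
    case True
    then show ?thesis using a w by (auto intro: word_eq.refl)
  next
    case False
    \<comment> \<open>Insert a square behind the inverse letter; its first half then cancels that
      letter and its second half remains.\<close>
    have "coxeter_eq m ([(a, False)] @ pos_word [a, a] @ w) ([(a, False)] @ w)"
      using a w by (intro coxeter_eq_cancel) auto
    moreover have "coxeter_eq m ([] @ [(a, False), (a, \<not> False)] @ (a, True) # w) ([] @ (a, True) # w)"
      using a w by (intro word_eq.cancel) auto
    ultimately show ?thesis
      using False by (auto intro: word_eq.trans word_eq.sym)
  qed
  moreover have "coxeter_eq m ([(a, True)] @ w) ([(a, True)] @ pos_word (map fst w))"
    using Cons.IH[OF w] a by (intro word_eq_append_left) auto
  ultimately show ?case using x by (auto intro: word_eq.trans)
qed

text \<open>The runs s_j ... s_k, empty for k = j+1, represent the right cosets of the subgroup of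
  s_1, ..., s_{j-1}. An appended letter i preserves this shape: for i <= k-2 it crosses the run and
  joins \<open>v\<close>, for i = k-1 it lengthens the run, for i = k it cancels the last letter,
  and for i > k it crosses the run and joins \<open>v\<close> as i-1.\<close>

lemma coxeter_coset_representative:
  assumes "set w \<subseteq> {1..<Suc j}" "j < m"
  shows "\<exists>v k. set v \<subseteq> {1..<j} \<and> 1 \<le> k \<and> k \<le> Suc j \<and>
    coxeter_eq m (pos_word w) (pos_word (v @ rev [k..<Suc j]))"
  using assms(1)
proof (induction w rule: rev_induct)
  case Nil
  then show ?case
    by (intro exI[of _ "[]"] exI[of _ "Suc j"]) (simp add: word_eq.refl)
next
  case (snoc i w)
  then obtain v k where vk: "set v \<subseteq> {1..<j}" "1 \<le> k" "k \<le> Suc j"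
      "coxeter_eq m (pos_word w) (pos_word (v @ rev [k..<Suc j]))" by auto
  have i: "1 \<le> i" "i \<le> j" "i \<in> braid_gens m" using snoc.prems assms(2) by (auto simp: braid_gens_def)
  have v: "set v \<subseteq> {1..<m}" "pos_word v \<in> words (braid_gens m)"
    using vk(1) assms(2) by (auto simp: braid_gens_def)
  have eq: "coxeter_eq m (pos_word (w @ [i])) (pos_word (v @ rev [k..<Suc j] @ [i]))"
    using word_eq_append_right[OF vk(4), of "pos_word [i]"] i by simp
  have move: ?case if "pos_eq m (rev [k..<Suc j] @ [i]) ([l] @ rev [k..<Suc j])" "1 \<le> l" "l < j" for l
  proof (intro exI conjI)
    have "pos_eq m (v @ (rev [k..<Suc j] @ [i]) @ []) (v @ ([l] @ rev [k..<Suc j]) @ [])"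
      using that v by (intro pos_eq_cong) auto
    from word_eq.trans[OF eq] coxeter_eq_pos_eq[OF this]
    show "coxeter_eq m (pos_word (w @ [i])) (pos_word ((v @ [l]) @ rev [k..<Suc j]))"
      by (simp del: upt_Suc)
  qed (use that vk in auto)
  consider "i + 2 \<le> k" | "k = Suc i" | "k = i" | "k < i" by linarith
  then show ?case
  proof cases
    case 1
    show ?thesis
      by (rule move[of i], rule pos_eq_sym, rule pos_eq_commute_far) (use 1 i vk assms in auto)
  next
    case 2
    then have "[i..<Suc j] = i # [k..<Suc j]"
      using i by (simp add: upt_conv_Cons del: upt_Suc)
    then have "rev [k..<Suc j] @ [i] = rev [i..<Suc j]" by (simp del: upt_Suc)
    then show ?thesis using eq vk i
      by (intro exI[of _ v] exI[of _ i]) (simp del: upt_Suc)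
  next
    case 3
    have "[k..<Suc j] = k # [Suc k..<Suc j]"
      using i 3 by (simp add: upt_conv_Cons del: upt_Suc)
    then have "pos_word (v @ rev [k..<Suc j] @ [i]) =
        pos_word (v @ rev [Suc k..<Suc j]) @ pos_word [i, i] @ []"
      using 3 by (simp del: upt_Suc)
    moreover have "coxeter_eq m (pos_word (v @ rev [Suc k..<Suc j]) @ pos_word [i, i] @ [])
        (pos_word (v @ rev [Suc k..<Suc j]) @ [])"
      using i v assms(2) by (intro coxeter_eq_cancel) (auto simp: braid_gens_def)
    ultimately have "coxeter_eq m (pos_word (w @ [i])) (pos_word (v @ rev [Suc k..<Suc j]))"
      using eq word_eq.trans by (metis append_Nil2)
    then show ?thesis using vk i 3 by (intro exI[of _ v] exI[of _ "Suc k"]) auto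
  next
    case 4
    show ?thesis
      using descending_shift[of k "i - 1" j m] i vk assms(2) 4 by (intro move[of "i - 1"]) auto
  qed
qed

lemma word_perm_coxeter_eq:
  assumes "coxeter_eq m u v"
  shows "word_perm m u = word_perm m v"
proof (rule word_eval_eq[OF sym_group_is_group transpose_in_sym_group _ assms])
  fix l r assume "(l, r) \<in> coxeter_rels m"
  then show "word_perm m l = word_perm m r"
    using braid_rels_sym_group by (auto simp: coxeter_rels_def sym_group_def)
qed

lemma word_perm_append:
  assumes "u \<in> words (braid_gens m)" "v \<in> words (braid_gens m)"
  shows "word_perm m (u @ v) = word_perm m u \<circ> word_perm m v"
  using word_eval_append[OF sym_group_is_group transpose_in_sym_group assms]
  by (simp add: sym_group_def)

lemma word_perm_fixes: "set u \<subseteq> {..<j} \<Longrightarrow> word_perm m (pos_word u) (Suc j) = Suc j"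
  by (induction u) (auto simp: sym_group_def transpose_def)

text \<open>Products act from right to left, so s_k comes first and each further letter carries the
  point one step up. This tells the cosets apart.\<close>

lemma word_perm_descending:
  assumes "1 \<le> k" "k \<le> Suc j" "j < m"
  shows "word_perm m (pos_word (rev [k..<Suc j])) k = Suc j"
  using assms(2,3)
proof (induction j)
  case 0
  then show ?case using assms(1) by (simp add: sym_group_def)
next
  case (Suc j)
  show ?case
  proof (cases "k = Suc (Suc j)")
    case False
    then show ?thesis using Suc by (simp add: sym_group_def)
  qed (simp add: sym_group_def)
qed

text \<open>In the normal form the run sends k to the top point, and \<open>v\<close> fixes the top
  point. A trivial permutation thus forces k to be the top point, the run is empty, and
  \<open>v\<close> uses one generator less.\<close>

lemma coxeter_eq_Nil_pos:
  assumes "set w \<subseteq> {1..<Suc j}" "j < m" "word_perm m (pos_word w) = id"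
  shows "coxeter_eq m (pos_word w) []"
  using assms
proof (induction j arbitrary: w)
  case 0
  then show ?case by (simp add: word_eq.refl)
next
  case (Suc j)
  obtain v k where vk: "set v \<subseteq> {1..<Suc j}" "1 \<le> k" "k \<le> Suc (Suc j)"
      "coxeter_eq m (pos_word w) (pos_word (v @ rev [k..<Suc (Suc j)]))"
    using coxeter_coset_representative[OF Suc.prems(1,2)] by blast
  have "word_perm m (pos_word (v @ rev [k..<Suc (Suc j)])) = id"
    unfolding word_perm_coxeter_eq[OF vk(4), symmetric] by (rule Suc.prems(3))
  also have "word_perm m (pos_word (v @ rev [k..<Suc (Suc j)])) =
      word_perm m (pos_word v) \<circ> word_perm m (pos_word (rev [k..<Suc (Suc j)]))"
    unfolding pos_word_simps(3)
    using vk Suc.prems(2) by (intro word_perm_append) (auto simp: braid_gens_def)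
  finally have "word_perm m (pos_word v) (word_perm m (pos_word (rev [k..<Suc (Suc j)])) k) = k"
    by (metis comp_apply id_apply)
  moreover have "word_perm m (pos_word (rev [k..<Suc (Suc j)])) k = Suc (Suc j)"
    using vk Suc.prems(2) by (intro word_perm_descending) auto
  moreover have "word_perm m (pos_word v) (Suc (Suc j)) = Suc (Suc j)"
    using vk(1) by (intro word_perm_fixes) auto
  ultimately have "k = Suc (Suc j)" by simp
  then have wv: "coxeter_eq m (pos_word w) (pos_word v)" using vk(4) by simp
  then have "coxeter_eq m (pos_word v) []"
    using vk(1) Suc.prems word_perm_coxeter_eq[OF wv] by (intro Suc.IH) auto
  with wv show ?case by (rule word_eq.trans)
qed

lemma coxeter_eq_Nil:
  assumes "w \<in> words (braid_gens m)" "word_perm m w = id"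
  shows "coxeter_eq m w []"
proof (cases m)
  case 0
  then have "w = []" using assms(1) by (cases w) (auto simp: braid_gens_def)
  then show ?thesis by (simp add: word_eq.refl)
next
  case (Suc j)
  note pos = coxeter_eq_pos_word[OF assms(1)]
  have "set (map fst w) \<subseteq> {1..<Suc j}"
    using assms(1) Suc by (auto simp: words_def braid_gens_def)
  then have "coxeter_eq m (pos_word (map fst w)) []"
    using word_perm_coxeter_eq[OF pos] assms(2) Suc by (intro coxeter_eq_Nil_pos) auto
  with pos show ?thesis by (rule word_eq.trans)
qed

section \<open>The subgroup generated by the full twists\<close>

text \<open>Conjugation is a homomorphism, so generators suffice. The inclusion is one-sided and
  does not pass to the inverse of \<open>g\<close>, which is why each s_k and its inverse are
  treated separately later.\<close>

lemma (in group) generate_conj_closed: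
  assumes X: "X \<subseteq> carrier G" and g: "g \<in> carrier G"
    and conj: "\<And>x. x \<in> X \<Longrightarrow> g \<otimes> x \<otimes> inv g \<in> generate G X"
    and "h \<in> generate G X"
  shows "g \<otimes> h \<otimes> inv g \<in> generate G X"
  using assms(4)
proof (induction rule: generate.induct)
  case one
  then show ?case using g by (simp add: generate.one)
next
  case (incl h)
  then show ?case by (rule conj)
next
  case (inv h)
  have "g \<otimes> inv h \<otimes> inv g = inv (g \<otimes> h \<otimes> inv g)"
    using inv X g by (auto simp: inv_mult_group m_assoc)
  then show ?case using generate_m_inv_closed[OF X conj[OF inv]] by simp
next
  case (eng h1 h2)
  have "h1 \<in> carrier G" "h2 \<in> carrier G"
    using eng generate_in_carrier[OF X] by auto
  then have "g \<otimes> (h1 \<otimes> h2) \<otimes> inv g = (g \<otimes> h1 \<otimes> inv g) \<otimes> (g \<otimes> h2 \<otimes> inv g)"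
    using g by (simp add: m_assoc inv_solve_left)
  then show ?case using eng by (simp add: generate.eng)
qed

lemma pos_braid_closed: "set u \<subseteq> {1..<m} \<Longrightarrow> pos_braid m u \<in> carrier (braid_group m)"
  unfolding pos_braid_def braid_group_def presented_group_carrier
  by (auto simp: braid_gens_def)

lemma pos_braid_append:
  "set u \<subseteq> {1..<m} \<Longrightarrow> set v \<subseteq> {1..<m} \<Longrightarrow>
    pos_braid m (u @ v) = pos_braid m u \<otimes>\<^bsub>braid_group m\<^esub> pos_braid m v"
  by (simp add: pos_braid_def braid_group_def presented_group_mult braid_gens_def)

lemma pos_braid_Nil: "pos_braid m [] = \<one>\<^bsub>braid_group m\<^esub>"
  by (simp add: pos_braid_def braid_group_def presented_group_one)

lemma pos_braid_eq: "pos_eq m u v \<Longrightarrow> pos_braid m u = pos_braid m v"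
  unfolding pos_eq_def pos_braid_def
  using word_class_eq_iff word_eq_words by blast

definition full_twists :: "nat \<Rightarrow> nat gword set set" where
  "full_twists m = {pos_braid m (full_twist i j) | i j. 1 \<le> i \<and> i < j \<and> j \<le> m}"

lemma full_twists_carrier: "full_twists m \<subseteq> carrier (braid_group m)"
  unfolding full_twists_def using pos_braid_closed set_full_twist_gens by fastforce

text \<open>The case \<open>i = j\<close>, a trivial twist, covers the empty factor left beside a
  palindrome when the interval is a single generator.\<close>

lemma full_twist_in_generate:
  assumes "1 \<le> i" "i \<le> j" "j \<le> m"
  shows "pos_braid m (full_twist i j) \<in> generate (braid_group m) (full_twists m)"
proof (cases "i = j")
  case True
  then show ?thesis by (simp add: pos_braid_Nil generate.one)
next
  case False
  then have "pos_braid m (full_twist i j) \<in> full_twists m"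
    using assms unfolding full_twists_def by force
  then show ?thesis by (rule generate.incl)
qed

text \<open>Serves to extract a palindrome as the quotient of two twists while the words themselves
  stay positive.\<close>

lemma pos_braid_suffix_in_generate:
  assumes "set u \<subseteq> {1..<m}" "set v \<subseteq> {1..<m}"
    and "pos_braid m u \<in> generate (braid_group m) (full_twists m)"
    and "pos_braid m (u @ v) \<in> generate (braid_group m) (full_twists m)"
  shows "pos_braid m v \<in> generate (braid_group m) (full_twists m)"
proof -
  interpret B: group "braid_group m" by (rule braid_group_is_group)
  have "pos_braid m v = inv\<^bsub>braid_group m\<^esub> pos_braid m u \<otimes>\<^bsub>braid_group m\<^esub> pos_braid m (u @ v)"
    using assms(1,2)
    by (simp add: pos_braid_append pos_braid_closed B.inv_solve_left)
  then show ?thesis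
    using B.generate_m_inv_closed[OF full_twists_carrier assms(3)] assms(4)
    by (simp add: generate.eng)
qed

lemma pos_braid_append_in_generate:
  assumes "set u \<subseteq> {1..<m}" "set v \<subseteq> {1..<m}"
    and "pos_braid m u \<in> generate (braid_group m) (full_twists m)"
    and "pos_braid m v \<in> generate (braid_group m) (full_twists m)"
  shows "pos_braid m (u @ v) \<in> generate (braid_group m) (full_twists m)"
  using assms by (simp add: pos_braid_append generate.eng)

lemma square_in_generate:
  assumes "1 \<le> k" "k < m"
  shows "pos_braid m [k, k] \<in> generate (braid_group m) (full_twists m)"
  using full_twist_in_generate[of k "Suc k" m] assms by (simp add: full_twist_single)

text \<open>A generator far from the interval or inside it commutes with the twist, which leaves the
  twist times s_k^2. A generator adjacent to either end yields a shorter twist times a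
  palindrome.\<close>

lemma sandwiched_full_twist_in_generate:
  assumes "1 \<le> i" "i < j" "j \<le> m" "1 \<le> k" "k < m"
  shows "pos_braid m ([k] @ full_twist i j @ [k]) \<in> generate (braid_group m) (full_twists m)"
proof -
  have k: "set [k] \<subseteq> {1..<m}" using assms by auto
  have comm: ?thesis if "pos_eq m ([k] @ full_twist i j) (full_twist i j @ [k])"
  proof -
    have "pos_eq m (([k] @ full_twist i j) @ [k]) ((full_twist i j @ [k]) @ [k])"
      using k by (intro pos_eq_append[OF that] pos_eq_refl) auto
    then have "pos_braid m ([k] @ full_twist i j @ [k]) = pos_braid m (full_twist i j @ [k, k])"
      by (simp add: pos_braid_eq)
    then show ?thesis
      using assms set_full_twist_gens[of i j m]
        pos_braid_append_in_generate[OF _ _ full_twist_in_generate square_in_generate]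
      by simp
  qed
  consider "k + 2 \<le> i \<or> j + 1 \<le> k" | "i \<le> k" "k < j" | "k = j" | "i = Suc k"
    by linarith
  then show ?thesis
  proof cases
    case 1
    show ?thesis
      using 1 k assms set_full_twist_gens[of i j m] set_full_twist[of i j]
      by (intro comm pos_eq_commute_far) fastforce+
  next
    case 2
    then show ?thesis using assms by (intro comm pos_eq_sym[OF full_twist_commute]) auto
  next
    case 3
    obtain j' where j: "j = Suc j'" using assms by (cases j) auto
    let ?p = "rev [i..<Suc (Suc j')] @ [i..<Suc (Suc j')]"
    have p: "set ?p \<subseteq> {1..<m}" using assms 3 j by auto
    have t: "set (full_twist i j') \<subseteq> {1..<m}" "set (full_twist i (Suc j')) \<subseteq> {1..<m}"
      "pos_braid m (full_twist i j') \<in> generate (braid_group m) (full_twists m)"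
      "pos_braid m (full_twist i (Suc j')) \<in> generate (braid_group m) (full_twists m)"
      "pos_braid m (full_twist i (Suc (Suc j'))) \<in> generate (braid_group m) (full_twists m)"
      using assms 3 j by (intro set_full_twist_gens full_twist_in_generate; simp)+
    have eq: "pos_braid m (full_twist i (Suc j') @ ?p) = pos_braid m (full_twist i (Suc (Suc j')))"
      using assms 3 j by (intro pos_braid_eq[symmetric] full_twist_Suc) auto
    \<comment> \<open>The palindrome is the inverse of \<open>full_twist i (Suc j')\<close> times
      \<open>full_twist i (Suc (Suc j'))\<close>.\<close>
    have "pos_braid m ?p \<in> generate (braid_group m) (full_twists m)"
      by (rule pos_braid_suffix_in_generate[OF t(2) p t(4)], subst eq, rule t(5))
    with t(1,3) p have "pos_braid m (full_twist i j' @ ?p) \<in> generate (braid_group m) (full_twists m)"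
      by (simp only: pos_braid_append_in_generate)
    then show ?thesis
      using pos_braid_eq[OF full_twist_conj_right[of i j' m]] assms 3 j by (simp only: less_Suc_eq_le)
  next
    case 4
    obtain j' where j: "j = Suc j'" using assms by (cases j) auto
    let ?p = "[k..<Suc j'] @ rev [k..<Suc j']"
    have p: "set ?p \<subseteq> {1..<m}" using assms 4 j by auto
    have t: "set (full_twist (Suc (Suc k)) (Suc j')) \<subseteq> {1..<m}" "set (full_twist (Suc k) (Suc j')) \<subseteq> {1..<m}"
      "pos_braid m (full_twist (Suc (Suc k)) (Suc j')) \<in> generate (braid_group m) (full_twists m)"
      "pos_braid m (full_twist (Suc k) (Suc j')) \<in> generate (braid_group m) (full_twists m)"
      "pos_braid m (full_twist k (Suc j')) \<in> generate (braid_group m) (full_twists m)"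
      using assms 4 j by (intro set_full_twist_gens full_twist_in_generate; simp)+
    have eq: "pos_braid m (full_twist (Suc k) (Suc j') @ ?p) = pos_braid m (full_twist k (Suc j'))"
      using assms 4 j by (intro pos_braid_eq[symmetric] full_twist_Suc_left) auto
    have "pos_braid m ?p \<in> generate (braid_group m) (full_twists m)"
      by (rule pos_braid_suffix_in_generate[OF t(2) p t(4)], subst eq, rule t(5))
    with t(1,3) p have "pos_braid m (full_twist (Suc (Suc k)) (Suc j') @ ?p)
        \<in> generate (braid_group m) (full_twists m)"
      by (simp only: pos_braid_append_in_generate)
    then show ?thesis
      using pos_braid_eq[OF full_twist_conj_left[of k j' m]] assms 4 j by (simp only: less_Suc_eq_le Suc_le_eq)
  qed
qed

section \<open>Normality of the generated subgroup\<close>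

abbreviation braid_class :: "nat \<Rightarrow> nat gword \<Rightarrow> nat gword set" where
  "braid_class m \<equiv> word_class (braid_gens m) (braid_rels m)"

lemma braid_class_closed: "w \<in> words (braid_gens m) \<Longrightarrow> braid_class m w \<in> carrier (braid_group m)"
  unfolding braid_group_def presented_group_carrier by blast

lemma braid_class_Cons:
  assumes "a \<in> braid_gens m" "w \<in> words (braid_gens m)"
  shows "braid_class m ((a, b) # w) = (if b then pos_braid m [a]
    else inv\<^bsub>braid_group m\<^esub> pos_braid m [a]) \<otimes>\<^bsub>braid_group m\<^esub> braid_class m w"
proof -
  interpret B: group "braid_group m" by (rule braid_group_is_group)
  have mult: "braid_class m (u @ v) = braid_class m u \<otimes>\<^bsub>braid_group m\<^esub> braid_class m v"
    if "u \<in> words (braid_gens m)" "v \<in> words (braid_gens m)" for u v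
    using that by (simp add: braid_group_def presented_group_mult)
  have "word_eq (braid_gens m) (braid_rels m) [(a, False), (a, True)] []"
    using word_eq.cancel[of a "braid_gens m" "[]" "[]" "braid_rels m" False] assms by simp
  then have "braid_class m ([(a, False)] @ [(a, True)]) = \<one>\<^bsub>braid_group m\<^esub>"
    using assms by (simp add: braid_group_def presented_group_one word_class_eq_iff)
  then have "braid_class m [(a, False)] \<otimes>\<^bsub>braid_group m\<^esub> braid_class m [(a, True)] = \<one>\<^bsub>braid_group m\<^esub>"
    using assms mult[of "[(a, False)]" "[(a, True)]"] by simp
  then have "braid_class m [(a, False)] = inv\<^bsub>braid_group m\<^esub> braid_class m [(a, True)]"
    using assms by (intro B.inv_equality[symmetric] braid_class_closed) auto
  then show ?thesis
    using mult[of "[(a, b)]" w] assms by (cases b) (simp_all add: pos_braid_def)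
qed

text \<open>One positive computation serves both signs: s x s^{-1} = (s x s) s^{-2} and s^{-1} x s =
  s^{-2} (s x s). Conjugation by an arbitrary braid is then iterated conjugation by the letters of a
  word for it.\<close>

lemma generate_full_twists_normal:
  "generate (braid_group m) (full_twists m) \<lhd> braid_group m"
proof -
  interpret B: group "braid_group m" by (rule braid_group_is_group)
  let ?H = "generate (braid_group m) (full_twists m)"
  have gen: "g \<otimes>\<^bsub>braid_group m\<^esub> h \<otimes>\<^bsub>braid_group m\<^esub> inv\<^bsub>braid_group m\<^esub> g \<in> ?H"
    if k: "k \<in> braid_gens m" and h: "h \<in> ?H"
      and g: "g = pos_braid m [k] \<or> g = inv\<^bsub>braid_group m\<^esub> pos_braid m [k]" for g h k
  proof -
    let ?s = "pos_braid m [k]"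
    have s: "?s \<in> carrier (braid_group m)" and k': "1 \<le> k" "k < m"
      using k by (auto simp: braid_gens_def intro!: pos_braid_closed)
    have ss: "?s \<otimes>\<^bsub>braid_group m\<^esub> ?s \<in> ?H"
      using square_in_generate[OF k'] pos_braid_append[of "[k]" m "[k]"] k' by simp
    then have ss': "inv\<^bsub>braid_group m\<^esub> (?s \<otimes>\<^bsub>braid_group m\<^esub> ?s) \<in> ?H"
      by (rule B.generate_m_inv_closed[OF full_twists_carrier])
    show ?thesis
    proof (rule B.generate_conj_closed[OF full_twists_carrier _ _ h])
      show "g \<in> carrier (braid_group m)" using g s by auto
      fix x assume "x \<in> full_twists m"
      then obtain i j where ij: "1 \<le> i" "i < j" "j \<le> m" and x: "x = pos_braid m (full_twist i j)"
        by (auto simp: full_twists_def)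
      have xc: "x \<in> carrier (braid_group m)"
        using \<open>x \<in> full_twists m\<close> full_twists_carrier by blast
      have sxs: "?s \<otimes>\<^bsub>braid_group m\<^esub> x \<otimes>\<^bsub>braid_group m\<^esub> ?s \<in> ?H"
        using sandwiched_full_twist_in_generate[OF ij k'] ij k' set_full_twist_gens[of i j m] s xc
          pos_braid_append[of "[k]" m "full_twist i j @ [k]"] pos_braid_append[of "full_twist i j" m "[k]"]
        by (simp add: x B.m_assoc)
      have si: "?s \<otimes>\<^bsub>braid_group m\<^esub> (inv\<^bsub>braid_group m\<^esub> ?s \<otimes>\<^bsub>braid_group m\<^esub> y) = y"
        "inv\<^bsub>braid_group m\<^esub> ?s \<otimes>\<^bsub>braid_group m\<^esub> (?s \<otimes>\<^bsub>braid_group m\<^esub> y) = y"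
        if "y \<in> carrier (braid_group m)" for y
        using that s by (simp_all flip: B.m_assoc)
      from g show "g \<otimes>\<^bsub>braid_group m\<^esub> x \<otimes>\<^bsub>braid_group m\<^esub> inv\<^bsub>braid_group m\<^esub> g \<in> ?H"
      proof
        assume "g = ?s"
        then have "g \<otimes>\<^bsub>braid_group m\<^esub> x \<otimes>\<^bsub>braid_group m\<^esub> inv\<^bsub>braid_group m\<^esub> g =
            (?s \<otimes>\<^bsub>braid_group m\<^esub> x \<otimes>\<^bsub>braid_group m\<^esub> ?s)
              \<otimes>\<^bsub>braid_group m\<^esub> inv\<^bsub>braid_group m\<^esub> (?s \<otimes>\<^bsub>braid_group m\<^esub> ?s)"
          using s xc by (simp add: B.m_assoc B.inv_mult_group si)
        then show ?thesis using generate.eng[OF sxs ss'] by simp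
      next
        assume "g = inv\<^bsub>braid_group m\<^esub> ?s"
        then have "g \<otimes>\<^bsub>braid_group m\<^esub> x \<otimes>\<^bsub>braid_group m\<^esub> inv\<^bsub>braid_group m\<^esub> g =
            inv\<^bsub>braid_group m\<^esub> (?s \<otimes>\<^bsub>braid_group m\<^esub> ?s)
              \<otimes>\<^bsub>braid_group m\<^esub> (?s \<otimes>\<^bsub>braid_group m\<^esub> x \<otimes>\<^bsub>braid_group m\<^esub> ?s)"
          using s xc by (simp add: B.m_assoc B.inv_mult_group si)
        then show ?thesis using generate.eng[OF ss' sxs] by simp
      qed
    qed
  qed
  have "braid_class m w \<otimes>\<^bsub>braid_group m\<^esub> h \<otimes>\<^bsub>braid_group m\<^esub> inv\<^bsub>braid_group m\<^esub> braid_class m w \<in> ?H"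
    if "w \<in> words (braid_gens m)" "h \<in> ?H" for w h
    using that
  proof (induction w)
    case Nil
    have "braid_class m [] = \<one>\<^bsub>braid_group m\<^esub>" by (simp add: braid_group_def presented_group_one)
    then show ?case using Nil B.generate_in_carrier[OF full_twists_carrier] by simp
  next
    case (Cons x w)
    obtain a b where x: "x = (a, b)" by fastforce
    let ?g = "if b then pos_braid m [a] else inv\<^bsub>braid_group m\<^esub> pos_braid m [a]"
    let ?w = "braid_class m w"
    have a: "a \<in> braid_gens m" and w: "w \<in> words (braid_gens m)" using Cons.prems x by auto
    have "?g \<in> carrier (braid_group m)"
      using a by (auto simp: braid_gens_def intro!: pos_braid_closed)
    then have "?g \<otimes>\<^bsub>braid_group m\<^esub> ?w \<otimes>\<^bsub>braid_group m\<^esub> h \<otimes>\<^bsub>braid_group m\<^esub>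
          inv\<^bsub>braid_group m\<^esub> (?g \<otimes>\<^bsub>braid_group m\<^esub> ?w) =
        ?g \<otimes>\<^bsub>braid_group m\<^esub> (?w \<otimes>\<^bsub>braid_group m\<^esub> h \<otimes>\<^bsub>braid_group m\<^esub> inv\<^bsub>braid_group m\<^esub> ?w)
          \<otimes>\<^bsub>braid_group m\<^esub> inv\<^bsub>braid_group m\<^esub> ?g"
      using braid_class_closed[OF w] B.generate_in_carrier[OF full_twists_carrier Cons.prems(2)]
      by (simp only: B.m_assoc B.inv_mult_group B.m_closed B.inv_closed)
    moreover have "\<dots> \<in> ?H"
      using gen[OF a Cons.IH[OF w Cons.prems(2)], of ?g] by simp
    ultimately show ?case
      unfolding x braid_class_Cons[OF a w] by simp
  qed
  then show ?thesis
    unfolding B.normal_inv_iff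
    using B.generate_is_subgroup[OF full_twists_carrier]
    by (auto simp: braid_group_def presented_group_carrier)
qed

section \<open>Passage to the quotient by the full twists\<close>

text \<open>For the quotient map this gives its values letter by letter, so that
  \<open>word_eval_eq\<close> becomes applicable with the larger set of Coxeter relations.\<close>

lemma hom_braid_class:
  assumes "group_hom (braid_group m) K h" "w \<in> words (braid_gens m)"
  shows "h (braid_class m w) = word_eval K (\<lambda>i. h (pos_braid m [i])) w"
proof -
  interpret group_hom "braid_group m" K h by fact
  show ?thesis using assms(2)
  proof (induction w)
    case Nil
    have "braid_class m [] = \<one>\<^bsub>braid_group m\<^esub>"
      by (simp add: braid_group_def presented_group_one)
    then show ?case by simp
  next
    case (Cons x w)
    obtain a b where x: "x = (a, b)" by fastforce
    have aw: "a \<in> braid_gens m" "w \<in> words (braid_gens m)" using Cons.prems x by auto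
    have "pos_braid m [a] \<in> carrier (braid_group m)" "braid_class m w \<in> carrier (braid_group m)"
      using braid_class_closed[OF aw(2)] aw(1) by (auto simp: braid_gens_def intro!: pos_braid_closed)
    then show ?case
      using Cons.IH[OF aw(2)] by (auto simp: x braid_class_Cons[OF aw])
  qed
qed

lemma braid_perm_class: "w \<in> words (braid_gens m) \<Longrightarrow> braid_perm m (braid_class m w) = word_perm m w"
  unfolding braid_perm_def
  by (rule presented_lift_class[OF sym_group_is_group transpose_in_sym_group braid_rels_sym_group])

lemma pure_braid_group_subset:
  "pure_braid_group m \<subseteq> generate (braid_group m) (full_twists m)"
proof
  let ?H = "generate (braid_group m) (full_twists m)"
  let ?Q = "braid_group m Mod ?H"
  let ?f = "\<lambda>i. ?H #>\<^bsub>braid_group m\<^esub> pos_braid m [i]"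
  interpret N: normal ?H "braid_group m" by (rule generate_full_twists_normal)
  have Q: "group ?Q" by (rule N.factorgroup_is_group)
  interpret q: group_hom "braid_group m" ?Q "\<lambda>g. ?H #>\<^bsub>braid_group m\<^esub> g"
    using Q N.r_coset_hom_Mod by (simp add: group_hom_def group_hom_axioms_def N.is_group)
  fix X assume "X \<in> pure_braid_group m"
  then obtain w where w: "w \<in> words (braid_gens m)" "X = braid_class m w" "braid_perm m X = id"
    by (auto simp: pure_braid_group_def kernel_def braid_group_def presented_group_carrier sym_group_def)
  have "coxeter_eq m w []"
    using w by (intro coxeter_eq_Nil) (auto simp: braid_perm_class)
  \<comment> \<open>The Coxeter relations hold in the quotient: the braid relations are inherited,
    and each s_i^2 lies in \<open>?H\<close>.\<close>
  have "word_eval ?Q ?f w = word_eval ?Q ?f []"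
  proof (rule word_eval_eq[OF Q _ _ \<open>coxeter_eq m w []\<close>])
    show "?f \<in> braid_gens m \<rightarrow> carrier ?Q"
      by (auto simp: braid_gens_def intro!: q.hom_closed pos_braid_closed)
    fix l r assume "(l, r) \<in> coxeter_rels m"
    then consider "(l, r) \<in> braid_rels m"
      | i where "i \<in> braid_gens m" "l = pos_word [i, i]" "r = []"
      by (auto simp: coxeter_rels_def)
    then show "word_eval ?Q ?f l = word_eval ?Q ?f r"
    proof cases
      case 1
      then have lr: "l \<in> words (braid_gens m)" "r \<in> words (braid_gens m)"
        by (auto simp: braid_rels_def)
      have "word_eq (braid_gens m) (braid_rels m) l r"
        using word_eq.rel[OF 1 lr, of "[]" "[]"] by simp
      then have "braid_class m l = braid_class m r"
        using lr by (simp add: word_class_eq_iff)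
      then show ?thesis using hom_braid_class[OF q.group_hom_axioms] lr by metis
    next
      case 2
      have i: "1 \<le> i" "i < m" using 2 by (auto simp: braid_gens_def)
      have "word_eval ?Q ?f l = ?H #>\<^bsub>braid_group m\<^esub> braid_class m (pos_word [i, i])"
        using hom_braid_class[OF q.group_hom_axioms, of "pos_word [i, i]"] 2 by simp
      also have "\<dots> = ?H"
        using square_in_generate[OF i] i pos_braid_closed[of "[i, i]" m]
        by (intro N.coset_join2 N.subgroup_axioms) (auto simp: pos_braid_def)
      finally show ?thesis using 2 by (simp add: FactGroup_def)
    qed
  qed
  then have "?H #>\<^bsub>braid_group m\<^esub> X = ?H"
    using hom_braid_class[OF q.group_hom_axioms w(1)] w(2) by (simp add: FactGroup_def)
  then show "X \<in> ?H"
    using N.coset_join1 braid_class_closed[OF w(1)] w(2) N.subgroup_axioms by blast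
qed

section \<open>Full twists are pure braids\<close>

text \<open>The palindrome collapses from the middle, where the first letter of \<open>u\<close>
  meets its own copy.\<close>

lemma word_perm_desc_asc:
  assumes "set u \<subseteq> braid_gens m"
  shows "word_perm m (pos_word (rev u @ u)) = id"
  using assms
proof (induction u)
  case Nil
  then show ?case by (simp add: sym_group_def)
next
  case (Cons i u)
  have "coxeter_eq m (pos_word (rev u) @ pos_word [i, i] @ pos_word u) (pos_word (rev u) @ pos_word u)"
    using Cons.prems by (intro coxeter_eq_cancel) auto
  from word_perm_coxeter_eq[OF this] Cons show ?case by simp
qed

text \<open>By \<open>full_twist_Suc\<close> a full twist is a product of palindromes, each with
  trivial permutation.\<close>

lemma word_perm_full_twist:
  assumes "1 \<le> i" "i \<le> j" "j \<le> m"
  shows "word_perm m (pos_word (full_twist i j)) = id"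
  using assms(2,3)
proof (induction j rule: dec_induct)
  case base
  then show ?case by (simp add: sym_group_def)
next
  case (step j)
  let ?p = "rev [i..<Suc j] @ [i..<Suc j]"
  have "word_perm m (pos_word (full_twist i (Suc j))) = word_perm m (pos_word (full_twist i j @ ?p))"
    using step assms(1) by (intro word_perm_coxeter_eq coxeter_eq_pos_eq full_twist_Suc) auto
  also have "\<dots> = word_perm m (pos_word (full_twist i j)) \<circ> word_perm m (pos_word ?p)"
    unfolding pos_word_simps(3)[of "full_twist i j" ?p]
    using step assms(1) set_full_twist_gens[of i j m]
    by (intro word_perm_append) (auto simp: braid_gens_def)
  also have "word_perm m (pos_word ?p) = id"
    using step assms(1) by (intro word_perm_desc_asc) (auto simp: braid_gens_def)
  finally show ?case using step by simp
qed

lemma generate_full_twists_subset: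
  "generate (braid_group m) (full_twists m) \<subseteq> pure_braid_group m"
proof -
  interpret p: group_hom "braid_group m" "sym_group m" "braid_perm m"
    by (simp add: group_hom_def group_hom_axioms_def braid_group_is_group sym_group_is_group braid_perm_hom)
  have "full_twists m \<subseteq> pure_braid_group m"
  proof
    fix X assume X: "X \<in> full_twists m"
    then obtain i j where ij: "1 \<le> i" "i < j" "j \<le> m" "X = pos_braid m (full_twist i j)"
      by (auto simp: full_twists_def)
    have "pos_word (full_twist i j) \<in> words (braid_gens m)"
      using ij set_full_twist_gens[of i j m] by (simp add: braid_gens_def)
    then have "braid_perm m X = id"
      using ij word_perm_full_twist[of i j m] by (simp add: pos_braid_def braid_perm_class)
    then show "X \<in> pure_braid_group m"
      using X full_twists_carrier by (auto simp: pure_braid_group_def kernel_def sym_group_def)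
  qed
  then show ?thesis
    using p.G.generate_subgroup_incl p.subgroup_kernel unfolding pure_braid_group_def by blast
qed

section \<open>From connected subgraphs to full twists\<close>

lemma ell_square:
  assumes "1 \<le> i" "i \<le> j" "j < m"
  shows "ell m i j [^]\<^bsub>braid_group m\<^esub> (2::nat) = pos_braid m (full_twist i (Suc j))"
proof -
  interpret B: group "braid_group m" by (rule braid_group_is_group)
  have u: "set (half_twist i (Suc j)) \<subseteq> {1..<m}"
    using assms by (intro set_half_twist_gens) auto
  show ?thesis
    using pos_braid_closed[OF u] pos_braid_append[OF u u]
    by (simp add: ell_def ell_word_half_twist full_twist_def numeral_2_eq_2)
qed

text \<open>The braid of a subgraph depends only on its vertex set, so the index set may be replaced
  by the intervals of \<open>connected_subgraphs_A_verts\<close>.\<close>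

lemma ell_subgraph_squares:
  "{ell_subgraph (n + 1) A [^]\<^bsub>braid_group (n + 1)\<^esub> (2::nat) | A. A \<in> connected_subgraphs_A n}
    = full_twists (n + 1)"
proof -
  have mm: "Min {i..j} = i" "Max {i..j} = j" if "i \<le> j" for i j :: nat
    using that by (auto intro!: Min_eqI Max_eqI)
  have "{ell_subgraph (n + 1) A [^]\<^bsub>braid_group (n + 1)\<^esub> (2::nat) | A. A \<in> connected_subgraphs_A n} =
      (\<lambda>V. ell (n + 1) (Min V) (Max V) [^]\<^bsub>braid_group (n + 1)\<^esub> (2::nat)) ` verts ` connected_subgraphs_A n"
      (is "_ = ?f ` _ ` _")
    by (auto simp: ell_subgraph_def)
  also have "\<dots> = {ell (n + 1) i j [^]\<^bsub>braid_group (n + 1)\<^esub> (2::nat) | i j. 1 \<le> i \<and> i \<le> j \<and> j \<le> n}"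
  proof (intro equalityI subsetI)
    fix X assume "X \<in> {ell (n + 1) i j [^]\<^bsub>braid_group (n + 1)\<^esub> (2::nat) | i j. 1 \<le> i \<and> i \<le> j \<and> j \<le> n}"
    then obtain i j where ij: "1 \<le> i" "i \<le> j" "j \<le> n"
      and X: "X = ell (n + 1) i j [^]\<^bsub>braid_group (n + 1)\<^esub> (2::nat)" by blast
    have "{i..j} \<in> verts ` connected_subgraphs_A n"
      unfolding connected_subgraphs_A_verts using ij by blast
    then show "X \<in> ?f ` verts ` connected_subgraphs_A n"
      by (rule rev_image_eqI) (simp only: X mm[OF ij(2)])
  next
    fix X assume "X \<in> ?f ` verts ` connected_subgraphs_A n"
    then obtain i j where ij: "1 \<le> i" "i \<le> j" "j \<le> n" and X: "X = ?f {i..j}"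
      unfolding connected_subgraphs_A_verts by blast
    then have "X = ell (n + 1) i j [^]\<^bsub>braid_group (n + 1)\<^esub> (2::nat)" by (simp only: mm)
    with ij show "X \<in> {ell (n + 1) i j [^]\<^bsub>braid_group (n + 1)\<^esub> (2::nat) | i j. 1 \<le> i \<and> i \<le> j \<and> j \<le> n}"
      by blast
  qed
  also have "\<dots> = {pos_braid (n + 1) (full_twist i (Suc j)) | i j. 1 \<le> i \<and> i \<le> j \<and> j \<le> n}"
    by (rule Collect_cong) (metis Suc_eq_plus1 ell_square le_imp_less_Suc)
  also have "\<dots> = full_twists (n + 1)"
  proof (intro equalityI subsetI)
    fix X assume "X \<in> full_twists (n + 1)"
    then obtain i j where "1 \<le> i" "i < j" "j \<le> n + 1" "X = pos_braid (n + 1) (full_twist i j)"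
      by (auto simp: full_twists_def)
    \<comment> \<open>Back from the exclusive to the inclusive upper bound; the subtraction does not
      truncate because i < j.\<close>
    then have "X = pos_braid (n + 1) (full_twist i (Suc (j - 1))) \<and> 1 \<le> i \<and> i \<le> j - 1 \<and> j - 1 \<le> n"
      by auto
    then show "X \<in> {pos_braid (n + 1) (full_twist i (Suc j)) | i j. 1 \<le> i \<and> i \<le> j \<and> j \<le> n}"
      by blast
  qed (force simp: full_twists_def)
  finally show ?thesis .
qed

theorem proposition1p1:
  fixes n :: nat
  assumes "n \<ge> 1"
  shows "generate (braid_group (n + 1))
           {ell_subgraph (n + 1) A [^]\<^bsub>braid_group (n + 1)\<^esub> (2::nat) | A.
              A \<in> connected_subgraphs_A n}
         = pure_braid_group (n + 1)"
  unfolding ell_subgraph_squares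
  using pure_braid_group_subset generate_full_twists_subset by (rule equalityI[OF _ _, rotated])

end
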